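(* Let $K$ be a number field, let $\varphi:\mathbb{P}^1\to\mathbb{P}^1$ be a rational map of degree $\ge 2$ defined over $K$, and let $\beta\in\mathbb{P}^1(K)$. Suppose the number of Galois orbits for $\varphi^{-n}(\beta)$ is bounded by a constant independent of $n$. Then there exists an integer $l\ge 0$ such that for each $\beta_{l,i}\in\varphi^{-l}(\beta)$ and each $m\ge 0$, the points in $\varphi^{-m}(\beta_{l,i})$ are all Galois conjugates over $K$.
   Context: $\varphi^n$ denotes the $n$-th iterate of $\varphi$ and $\varphi^{-n}(\beta)\subset\mathbb{P}^1(\overline{K})$ is the set of preimages of $\beta$ under $\varphi^n$. The Galois orbits for $\varphi^{-n}(\beta)$ are the orbits of $\mathrm{Gal}(\overline{K}/K)$ acting on this set; points are Galois conjugates over $K$ if they lie in one orbit of $\mathrm{Gal}(\overline{K}/K)$ on $\mathbb{P}^1(\overline{K})$. *)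

theory Defs
  imports "HOL-Algebra.Algebraic_Closure_Type" "HOL-Algebra.Group_Action"
begin

text \<open>
  A field \<open>K\<close> of characteristic 0 is a type \<open>'k :: field_char_0\<close>, and its algebraic closure is the
  library type \<open>'k alg_closure\<close> with the embedding \<^const>\<open>to_ac\<close>.
\<close>

definition number_field :: "'k :: field_char_0 itself \<Rightarrow> bool" where
  "number_field (_ :: 'k itself) \<longleftrightarrow>
     (\<exists>B :: 'k set. finite B \<and> Modules.module.span (\<lambda>(c :: rat) x. of_rat c * x) B = UNIV)"

definition proj_rel :: "'a :: field \<times> 'a \<Rightarrow> 'a \<times> 'a \<Rightarrow> bool" where
  "proj_rel v w \<longleftrightarrow> v \<noteq> (0, 0) \<and> w \<noteq> (0, 0) \<and>
     (\<exists>c. c \<noteq> 0 \<and> fst w = c * fst v \<and> snd w = c * snd v)"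

text \<open>The projective line over \<open>'a\<close>: nonzero pairs up to scaling.\<close>

quotient_type (overloaded) 'a proj_line = "'a :: field \<times> 'a" / partial: proj_rel
proof (rule part_equivpI)
  show "\<exists>v :: 'a \<times> 'a. proj_rel v v"
    by (rule exI[of _ "(1, 0)"]) (auto simp: proj_rel_def intro: exI[of _ 1])
  show "symp (proj_rel :: 'a \<times> 'a \<Rightarrow> _)"
  proof (rule sympI)
    fix v w :: "'a \<times> 'a"
    assume "proj_rel v w"
    then obtain c where "v \<noteq> (0, 0)" "w \<noteq> (0, 0)" "c \<noteq> 0"
      "fst w = c * fst v" "snd w = c * snd v"
      unfolding proj_rel_def by blast
    then show "proj_rel w v"
      unfolding proj_rel_def by (intro conjI exI[of _ "inverse c"]) auto
  qed
  show "transp (proj_rel :: 'a \<times> 'a \<Rightarrow> _)"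
  proof (rule transpI)
    fix u v w :: "'a \<times> 'a"
    assume "proj_rel u v" "proj_rel v w"
    then obtain c d where "u \<noteq> (0, 0)" "w \<noteq> (0, 0)" "c \<noteq> 0" "d \<noteq> 0"
      "fst v = c * fst u" "snd v = c * snd u" "fst w = d * fst v" "snd w = d * snd v"
      unfolding proj_rel_def by blast
    then show "proj_rel u w"
      unfolding proj_rel_def by (intro conjI exI[of _ "d * c"]) auto
  qed
qed

text \<open>The point \<open>[x : y]\<close>; meaningful only for \<open>(x, y) \<noteq> (0, 0)\<close>.\<close>

definition proj_point :: "'a :: field \<Rightarrow> 'a \<Rightarrow> 'a proj_line" where
  "proj_point x y = abs_proj_line (x, y)"

lemma proj_point_eq_iff:
  assumes "(x, y) \<noteq> (0, 0)" "(x', y') \<noteq> (0, 0)"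
  shows "proj_point x y = proj_point x' y' \<longleftrightarrow> (\<exists>c. c \<noteq> 0 \<and> x' = c * x \<and> y' = c * y)"
proof -
  have refl: "proj_rel v v" if "v \<noteq> (0, 0)" for v :: "'a \<times> 'a"
    using that unfolding proj_rel_def by (intro conjI exI[of _ 1]) auto
  have "proj_rel (x, y) (x', y') \<longleftrightarrow> proj_point x y = proj_point x' y'"
    using Quotient3_rel[OF Quotient3_proj_line, of "(x, y)" "(x', y')"] refl assms
    unfolding proj_point_def by blast
  then show ?thesis
    using assms by (simp add: proj_rel_def)
qed

lemma proj_line_cases:
  obtains x y where "(x, y) \<noteq> (0, 0)" "P = proj_point x y" "rep_proj_line P = (x, y)"
proof -
  obtain x y where xy: "rep_proj_line P = (x, y)" by fastforce
  have "proj_rel (x, y) (x, y)"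
    using Quotient3_rep_reflp[OF Quotient3_proj_line, of P] xy by simp
  moreover have "P = proj_point x y"
    using Quotient3_abs_rep[OF Quotient3_proj_line, of P] xy by (simp add: proj_point_def)
  ultimately show ?thesis
    using that[of x y] xy unfolding proj_rel_def by blast
qed

definition rational_points :: "'k :: field alg_closure proj_line set" where
  "rational_points = {proj_point (to_ac x) (to_ac y) |x y. (x, y) \<noteq> (0, 0)}"

text \<open>
  The value at \<open>(x, y)\<close> of the degree-\<open>d\<close> homogenisation of \<open>p\<close>, that is of \<open>Y^d p(X/Y)\<close>,
  where \<open>degree p \<le> d\<close>.
\<close>

definition homog_eval :: "nat \<Rightarrow> 'k :: field poly \<Rightarrow> 'k alg_closure \<Rightarrow> 'k alg_closure \<Rightarrow> 'k alg_closure"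
  where "homog_eval d p x y = (\<Sum>i\<le>d. to_ac (coeff p i) * x ^ i * y ^ (d - i))"

text \<open>
  The map on geometric points given by \<open>p(z)/q(z)\<close> in lowest terms with coefficients in \<open>K\<close>,
  whose degree is the maximum of the degrees of \<open>p\<close> and \<open>q\<close>. Coprimality excludes \<open>p = q = 0\<close>
  and guarantees that the two homogenisations have no common zero.
\<close>

definition rational_map_of_degree ::
    "nat \<Rightarrow> ('k :: field alg_closure proj_line \<Rightarrow> 'k alg_closure proj_line) \<Rightarrow> bool" where
  "rational_map_of_degree d \<phi> \<longleftrightarrow>
     (\<exists>p q :: 'k poly. coprime p q \<and> d = max (degree p) (degree q) \<and>
        (\<forall>x y. (x, y) \<noteq> (0, 0) \<longrightarrow>
           \<phi> (proj_point x y) = proj_point (homog_eval d p x y) (homog_eval d q x y)))"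

definition iter_preimage :: "('a \<Rightarrow> 'a) \<Rightarrow> nat \<Rightarrow> 'a \<Rightarrow> 'a set" where
  "iter_preimage \<phi> n b = (\<phi> ^^ n) -` {b}"

definition absolute_galois_group :: "('k :: field alg_closure \<Rightarrow> 'k alg_closure) monoid" where
  "absolute_galois_group =
     \<lparr>carrier = {\<sigma>. bij \<sigma> \<and> (\<forall>x y. \<sigma> (x + y) = \<sigma> x + \<sigma> y) \<and> (\<forall>x y. \<sigma> (x * y) = \<sigma> x * \<sigma> y) \<and>
                 (\<forall>a. \<sigma> (to_ac a) = to_ac a)},
      monoid.mult = (\<circ>), one = id\<rparr>"

definition galois_action ::
    "('k :: field alg_closure \<Rightarrow> 'k alg_closure) \<Rightarrow> 'k alg_closure proj_line \<Rightarrow> 'k alg_closure proj_line"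
  where "galois_action \<sigma> P = (case rep_proj_line P of (x, y) \<Rightarrow> proj_point (\<sigma> x) (\<sigma> y))"

lemma galois_action_proj_point:
  assumes \<sigma>: "\<sigma> \<in> carrier absolute_galois_group" and xy: "(x, y) \<noteq> (0, 0)"
  shows "galois_action \<sigma> (proj_point x y) = proj_point (\<sigma> x) (\<sigma> y)"
proof -
  have inj: "inj \<sigma>" and mult: "\<And>a b. \<sigma> (a * b) = \<sigma> a * \<sigma> b"
    using \<sigma> by (auto simp: absolute_galois_group_def bij_def)
  have "\<sigma> (to_ac 0) = to_ac 0"
    using \<sigma> by (simp add: absolute_galois_group_def del: to_ac_0)
  then have zero: "\<sigma> a = 0 \<longleftrightarrow> a = 0" for a
    using injD[OF inj, of a 0] by auto
  obtain x' y' where 1: "(x', y') \<noteq> (0, 0)" "proj_point x y = proj_point x' y'"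
    "rep_proj_line (proj_point x y) = (x', y')"
    by (rule proj_line_cases)
  then obtain c where c: "c \<noteq> 0" "x' = c * x" "y' = c * y"
    using proj_point_eq_iff[OF xy] by blast
  have "proj_point (\<sigma> x) (\<sigma> y) = proj_point (\<sigma> x') (\<sigma> y')"
    using c 1 xy zero mult by (subst proj_point_eq_iff) (auto intro!: exI[of _ "\<sigma> c"])
  then show ?thesis
    using 1 by (simp add: galois_action_def)
qed

definition galois_orbits :: "'k :: field alg_closure proj_line set \<Rightarrow> 'k alg_closure proj_line set set" where
  "galois_orbits S = orbits absolute_galois_group S galois_action"

definition galois_conjugate :: "'k :: field alg_closure proj_line \<Rightarrow> 'k alg_closure proj_line \<Rightarrow> bool" where
  "galois_conjugate P Q \<longleftrightarrow> Q \<in> orbit absolute_galois_group galois_action P"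

end

theory Submission
  imports Defs
begin

text \<open>
  Since \<open>\<phi>\<close> is surjective and commutes with the Galois action, \<open>\<phi>\<^sup>m\<close> maps the orbits in
  \<open>\<phi>\<^sup>-\<^sup>l\<^sup>-\<^sup>m(\<beta>)\<close> onto those in \<open>\<phi>\<^sup>-\<^sup>l(\<beta>)\<close>. Hence the number of orbits is
  nondecreasing in the level, and being bounded it attains a maximum, say at level \<open>l\<close>. From there
  on the surjections between the finite sets of orbits are bijections, so two points with the
  same image under \<open>\<phi>\<^sup>m\<close> in \<open>\<phi>\<^sup>-\<^sup>l(\<beta>)\<close> lie in one orbit.
\<close>

section \<open>Bezout identities over K and over its algebraic closure\<close>

lemma coprime_poly_bezout:
  fixes p q :: "'a :: field poly"
  assumes "coprime p q"
  shows "\<exists>u v. u * p + v * q = 1"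
proof -
  have "p \<noteq> 0 \<or> q \<noteq> 0"
    using assms by auto
  \<comment> \<open>A nonzero combination of least degree divides every combination of
    \<open>p\<close> and \<open>q\<close>, since a nonzero remainder would be a combination of
    smaller degree. By coprimality it is then a unit.\<close>
  define I where "I = {g. g \<noteq> 0 \<and> (\<exists>u v. g = u * p + v * q)}"
  have "p = 1 * p + 0 * q" "q = 0 * p + 1 * q"
    by simp_all
  with \<open>p \<noteq> 0 \<or> q \<noteq> 0\<close> obtain g\<^sub>0 where "g\<^sub>0 \<in> I"
    unfolding I_def by blast
  then obtain g where g: "g \<in> I" and min: "\<And>h. h \<in> I \<Longrightarrow> degree g \<le> degree h"
    using ex_has_least_nat[of "\<lambda>g. g \<in> I" g\<^sub>0 degree] by blast
  obtain u v where uv: "g = u * p + v * q"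
    using g by (auto simp: I_def)
  have dvd: "g dvd s * p + t * q" for s t
  proof (rule ccontr)
    let ?h = "s * p + t * q"
    assume "\<not> g dvd ?h"
    then have nz: "?h mod g \<noteq> 0"
      by (simp add: dvd_eq_mod_eq_0)
    have "?h mod g = ?h - ?h div g * g"
      by (simp add: minus_div_mult_eq_mod)
    also have "\<dots> = (s - ?h div g * u) * p + (t - ?h div g * v) * q"
      by (subst (2) uv) (simp add: algebra_simps)
    finally have "degree g \<le> degree (?h mod g)"
      using min nz by (auto simp: I_def)
    moreover have "degree (?h mod g) < degree g"
      using degree_mod_less[of g ?h] g nz by (simp add: I_def)
    ultimately show False
      by simp
  qed
  have "is_unit g"
    using assms dvd[of 1 0] dvd[of 0 1] by (auto intro: coprime_common_divisor)
  then obtain w where "1 = g * w"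
    by (rule dvdE)
  then have "(w * u) * p + (w * v) * q = 1"
    by (simp add: uv algebra_simps)
  then show ?thesis
    by blast
qed

lemma map_poly_to_ac_add: "map_poly to_ac (p + q) = map_poly to_ac p + map_poly to_ac q"
  by (rule poly_eqI) (simp add: coeff_map_poly)

lemma map_poly_to_ac_mult: "map_poly to_ac (p * q) = map_poly to_ac p * map_poly to_ac q"
  by (rule poly_eqI) (simp add: coeff_map_poly coeff_mult to_ac_sum)

text \<open>A Bezout identity over K survives the embedding of coefficients, and so forbids common
  roots in the closure as well.\<close>

lemma coprime_map_poly_to_ac_bezout:
  fixes p q :: "'k :: field poly"
  assumes "coprime p q"
  shows "\<exists>u v. u * map_poly to_ac p + v * map_poly to_ac q = 1"
proof -
  obtain u v where "u * p + v * q = 1"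
    using coprime_poly_bezout[OF assms] by blast
  then have "map_poly to_ac (u * p + v * q) = 1"
    by simp
  then show ?thesis
    unfolding map_poly_to_ac_add map_poly_to_ac_mult by blast
qed

section \<open>Homogenised polynomials on the projective line\<close>

lemma homog_eval_eq_poly:
  assumes "degree p \<le> d" "y \<noteq> 0"
  shows "homog_eval d p x y = y ^ d * poly (map_poly to_ac p) (x / y)"
proof -
  \<comment> \<open>The terms added beyond \<open>degree p\<close> have coefficient 0.\<close>
  have "poly (map_poly to_ac p) (x / y) = (\<Sum>i\<le>d. to_ac (coeff p i) * (x / y) ^ i)"
    using assms unfolding poly_altdef
    by (intro sum.mono_neutral_cong_left) (auto simp: coeff_map_poly degree_map_poly coeff_eq_0)
  then show ?thesis
    using assms(2) unfolding homog_eval_def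
    by (simp only: sum_distrib_left) (auto intro!: sum.cong simp: power_divide power_diff field_simps)
qed

lemma homog_eval_at_infinity: "homog_eval d p x 0 = to_ac (coeff p d) * x ^ d"
proof -
  have "homog_eval d p x 0 = (\<Sum>i\<le>d. if i = d then to_ac (coeff p d) * x ^ d else 0)"
    unfolding homog_eval_def by (rule sum.cong) (auto simp: power_0_left)
  then show ?thesis
    by simp
qed

lemma homog_eval_galois:
  assumes "\<sigma> \<in> carrier absolute_galois_group"
  shows "homog_eval d p (\<sigma> x) (\<sigma> y) = \<sigma> (homog_eval d p x y)"
proof -
  have add: "\<sigma> (a + b) = \<sigma> a + \<sigma> b" and mult: "\<sigma> (a * b) = \<sigma> a * \<sigma> b"
    and fixed: "\<sigma> (to_ac c) = to_ac c" for a b c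
    using assms by (auto simp: absolute_galois_group_def)
  have zero: "\<sigma> 0 = 0" and one: "\<sigma> 1 = 1"
    using fixed[of 0] fixed[of 1] by simp_all
  have power: "\<sigma> (a ^ n) = \<sigma> a ^ n" for a n
    by (induction n) (simp_all add: one mult)
  have sum: "\<sigma> (sum f A) = (\<Sum>i\<in>A. \<sigma> (f i))" for f and A :: "nat set"
    by (induction A rule: infinite_finite_induct) (simp_all add: zero add)
  show ?thesis
    unfolding homog_eval_def by (simp add: sum mult power fixed)
qed

text \<open>Makes the value of the map a genuine point. At infinity one of \<open>p\<close>,
  \<open>q\<close> has degree exactly \<open>d\<close>, so its leading coefficient survives;
  elsewhere the Bezout identity excludes a common root.\<close>

lemma homog_eval_no_common_zero:
  assumes "coprime p q" "d = max (degree p) (degree q)" "(x, y) \<noteq> (0, 0)"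
  shows "(homog_eval d p x y, homog_eval d q x y) \<noteq> (0, 0)"
proof (cases "y = 0")
  case True
  have "p \<noteq> 0 \<or> q \<noteq> 0"
    using assms(1) by auto
  then have "coeff p d \<noteq> 0 \<or> coeff q d \<noteq> 0"
    using assms(2) by (cases "p = 0"; cases "q = 0") (auto simp: max_def)
  then show ?thesis
    using True assms(3) by (auto simp: homog_eval_at_infinity)
next
  case False
  obtain u v where "u * map_poly to_ac p + v * map_poly to_ac q = 1"
    using coprime_map_poly_to_ac_bezout[OF assms(1)] by blast
  then have "poly (u * map_poly to_ac p + v * map_poly to_ac q) (x / y) = 1"
    by simp
  then show ?thesis
    using False assms(2) by (auto simp: homog_eval_eq_poly)
qed

section \<open>Fibres of a rational map\<close>

lemma proj_point_eq_cross:
  assumes "(x, y) \<noteq> (0, 0)" "(a, b) \<noteq> (0, 0)"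
  shows "proj_point x y = proj_point a b \<longleftrightarrow> b * x = a * y"
proof -
  have "(\<exists>c. c \<noteq> 0 \<and> a = c * x \<and> b = c * y) \<longleftrightarrow> b * x = a * y"
  proof
    assume eq: "b * x = a * y"
    show "\<exists>c. c \<noteq> 0 \<and> a = c * x \<and> b = c * y"
    proof (cases "x = 0")
      case True
      then show ?thesis
        using eq assms by (intro exI[of _ "b / y"]) auto
    next
      case False
      then show ?thesis
        using eq assms by (intro exI[of _ "a / x"]) (auto simp: field_simps)
    qed
  qed auto
  then show ?thesis
    using assms by (simp add: proj_point_eq_iff)
qed

text \<open>The fibre over [a : b] is cut out by b p - a q: its roots are the finite points of the
  fibre, and infinity belongs to it when the coefficient at \<open>d\<close> vanishes.\<close>

lemma rational_map_fibre:
  fixes \<phi> :: "'k :: field alg_closure proj_line \<Rightarrow> 'k alg_closure proj_line"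
  assumes "rational_map_of_degree d \<phi>" "d > 0"
  shows "\<phi> -` {R} \<noteq> {}" "finite (\<phi> -` {R})"
proof -
  obtain p q :: "'k poly" where cop: "coprime p q" and d: "d = max (degree p) (degree q)"
    and \<phi>: "\<And>x y. (x, y) \<noteq> (0, 0) \<Longrightarrow>
      \<phi> (proj_point x y) = proj_point (homog_eval d p x y) (homog_eval d q x y)"
    using assms unfolding rational_map_of_degree_def by blast
  obtain a b where ab: "(a, b) \<noteq> (0, 0)" and R: "R = proj_point a b"
    by (rule proj_line_cases)
  have fibre: "\<phi> (proj_point x y) = R \<longleftrightarrow> b * homog_eval d p x y = a * homog_eval d q x y"
    if "(x, y) \<noteq> (0, 0)" for x y
    unfolding \<phi>[OF that] R
    by (rule proj_point_eq_cross[OF homog_eval_no_common_zero[OF cop d that] ab])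
  define F where "F = smult b (map_poly to_ac p) - smult a (map_poly to_ac q)"
  have affine: "\<phi> (proj_point z 1) = R \<longleftrightarrow> poly F z = 0" for z
    using d by (simp add: fibre F_def homog_eval_eq_poly)
  have infty: "\<phi> (proj_point 1 0) = R \<longleftrightarrow> coeff F d = 0"
    by (simp add: fibre F_def homog_eval_at_infinity coeff_map_poly)

  show "\<phi> -` {R} \<noteq> {}"
  proof (cases "degree F > 0")
    case True
    then obtain z where "poly F z = 0"
      using alg_closed_imp_poly_has_root by blast
    then show ?thesis
      using affine by blast
  next
    \<comment> \<open>A constant \<open>F\<close> has coefficient 0 at \<open>d > 0\<close>, so
      infinity lies in the fibre.\<close>
    case False
    then have "coeff F d = 0"
      using assms(2) by (simp add: coeff_eq_0)
    then show ?thesis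
      using infty by blast
  qed

  \<comment> \<open>If \<open>F = 0\<close>, then \<open>p\<close> and \<open>q\<close> are
    proportional over the closure, and the Bezout identity makes one of maximal degree a unit, hence
    constant, against \<open>d > 0\<close>.\<close>
  have "F \<noteq> 0"
  proof
    assume "F = 0"
    then have eq: "smult b (map_poly to_ac p) = smult a (map_poly to_ac q)"
      by (simp add: F_def)
    obtain u v where uv: "u * map_poly to_ac p + v * map_poly to_ac q = 1"
      using coprime_map_poly_to_ac_bezout[OF cop] by blast
    have unit: "is_unit (map_poly to_ac p) \<and> degree q \<le> degree p \<or>
                is_unit (map_poly to_ac q) \<and> degree p \<le> degree q"
    proof (cases "a = 0")
      case True
      then have "map_poly to_ac p = 0"
        using eq ab by simp
      then have "is_unit (map_poly to_ac q)" "degree p = 0"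
        using uv by (auto simp: dvd_def mult.commute map_poly_eq_0_iff)
      then show ?thesis
        by simp
    next
      case False
      then have q: "map_poly to_ac q = smult (b / a) (map_poly to_ac p)"
        using arg_cong[OF eq, of "smult (inverse a)"] by (simp add: field_simps)
      have "degree (map_poly to_ac q) \<le> degree (map_poly to_ac p)"
        unfolding q by (rule degree_smult_le)
      moreover have "map_poly to_ac p * (u + smult (b / a) v) = 1"
        using uv by (simp add: q algebra_simps)
      ultimately show ?thesis
        by (auto simp: degree_map_poly intro: dvdI[OF sym])
    qed
    have "degree f = 0" if "is_unit f" for f :: "'k alg_closure poly"
      using that by (auto simp: is_unit_poly_iff)
    from unit this[of "map_poly to_ac p"] this[of "map_poly to_ac q"] have "d = 0"
      using d by (auto simp: degree_map_poly)
    with assms(2) show False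
      by simp
  qed
  have "\<phi> -` {R} \<subseteq> insert (proj_point 1 0) ((\<lambda>z. proj_point z 1) ` {z. poly F z = 0})"
  proof
    fix P assume P: "P \<in> \<phi> -` {R}"
    obtain x y where xy: "(x, y) \<noteq> (0, 0)" "P = proj_point x y"
      by (rule proj_line_cases)
    show "P \<in> insert (proj_point 1 0) ((\<lambda>z. proj_point z 1) ` {z. poly F z = 0})"
    proof (cases "y = 0")
      case True
      then have "P = proj_point 1 0"
        using xy by (simp add: proj_point_eq_cross)
      then show ?thesis
        by simp
    next
      case False
      then have "P = proj_point (x / y) 1"
        using xy by (simp add: proj_point_eq_cross)
      then show ?thesis
        using P affine by auto
    qed
  qed
  then show "finite (\<phi> -` {R})"
    by (rule finite_subset) (simp add: poly_roots_finite[OF \<open>F \<noteq> 0\<close>])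
qed

section \<open>Galois equivariance and orbits\<close>

lemma rational_map_galois_equivariant:
  fixes \<phi> :: "'k :: field alg_closure proj_line \<Rightarrow> 'k alg_closure proj_line"
  assumes "rational_map_of_degree d \<phi>" and \<sigma>: "\<sigma> \<in> carrier absolute_galois_group"
  shows "\<phi> (galois_action \<sigma> P) = galois_action \<sigma> (\<phi> P)"
proof -
  obtain p q :: "'k poly" where cop: "coprime p q" and d: "d = max (degree p) (degree q)"
    and \<phi>: "\<And>x y. (x, y) \<noteq> (0, 0) \<Longrightarrow>
      \<phi> (proj_point x y) = proj_point (homog_eval d p x y) (homog_eval d q x y)"
    using assms(1) unfolding rational_map_of_degree_def by blast
  obtain x y where xy: "(x, y) \<noteq> (0, 0)" "P = proj_point x y"
    by (rule proj_line_cases)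
  \<comment> \<open>That \<sigma> fixes 0 is an instance of fixing K, so \<open>to_ac 0\<close> must
    not be simplified first. With injectivity it keeps (\<sigma> x, \<sigma> y) nonzero.\<close>
  have "\<sigma> (to_ac 0) = to_ac 0" "inj \<sigma>"
    using \<sigma> by (simp_all add: absolute_galois_group_def bij_def del: to_ac_0)
  then have "\<sigma> z = 0 \<longleftrightarrow> z = 0" for z
    using injD[of \<sigma> z 0] by auto
  then have "(\<sigma> x, \<sigma> y) \<noteq> (0, 0)"
    using xy by simp
  then show ?thesis
    using \<sigma> xy homog_eval_no_common_zero[OF cop d xy(1)]
    by (simp add: galois_action_proj_point \<phi> homog_eval_galois del: prod.inject)
qed

lemma funpow_equivariant:
  assumes "\<And>x. f (g x) = g (f x)"
  shows "(f ^^ n) (g x) = g ((f ^^ n) x)"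
  by (induction n) (simp_all add: assms)

text \<open>Equivariance moves \<open>f\<close> past each group element. With an iterate of \<phi>
  as \<open>f\<close>, orbits at level l + m are pushed forward onto orbits at level l.\<close>

lemma image_orbit:
  assumes "\<And>g. g \<in> carrier G \<Longrightarrow> f (act g x) = act g (f x)"
  shows "f ` orbit G act x = orbit G act (f x)"
  using assms unfolding orbit_def by (auto simp: image_iff) metis

text \<open>Serves to turn an equality of two orbits into membership of a point.\<close>

lemma self_in_galois_orbit: "P \<in> orbit absolute_galois_group galois_action P"
proof -
  have "id \<in> carrier absolute_galois_group"
    by (simp add: absolute_galois_group_def)
  moreover have "galois_action id P = P"
    by (rule proj_line_cases[of P]) (simp add: galois_action_def)
  ultimately show ?thesis
    unfolding orbit_def by force
qed

section \<open>The tower of iterated preimages\<close>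

lemma finite_iter_preimage:
  assumes "\<And>R. finite (f -` {R})"
  shows "finite (iter_preimage f n b)"
proof (induction n)
  case (Suc n)
  have "iter_preimage f (Suc n) b = (\<Union>R\<in>iter_preimage f n b. f -` {R})"
    by (auto simp: iter_preimage_def funpow_swap1)
  then show ?case
    using Suc assms by simp
qed (simp add: iter_preimage_def)

text \<open>Level \<open>l + m\<close> is the full preimage of level \<open>l\<close> under
  \<open>f ^^ m\<close>, and iterates of a surjection are surjective.\<close>

lemma funpow_image_iter_preimage:
  assumes "surj f"
  shows "(f ^^ m) ` iter_preimage f (l + m) b = iter_preimage f l b"
proof -
  have "iter_preimage f (l + m) b = (f ^^ m) -` iter_preimage f l b"
    by (auto simp: iter_preimage_def funpow_add)
  then show ?thesis
    using assms by (simp add: surj_fn)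
qed

theorem theorem2p6:
  fixes \<phi> :: "'k :: field_char_0 alg_closure proj_line \<Rightarrow> 'k alg_closure proj_line"
    and \<beta> :: "'k alg_closure proj_line"
    and d :: nat
  assumes "number_field TYPE('k)"
    and "rational_map_of_degree d \<phi>" and "d \<ge> 2"
    and "\<beta> \<in> rational_points"
    and "\<exists>C :: nat. \<forall>n. card (galois_orbits (iter_preimage \<phi> n \<beta>)) \<le> C"
  shows "\<exists>l :: nat. \<forall>b \<in> iter_preimage \<phi> l \<beta>. \<forall>m :: nat.
           \<forall>P \<in> iter_preimage \<phi> m b. \<forall>Q \<in> iter_preimage \<phi> m b. galois_conjugate P Q"
proof -
  let ?S = "\<lambda>n. iter_preimage \<phi> n \<beta>"
  let ?orb = "orbit absolute_galois_group galois_action"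
  have "\<exists>P. R = \<phi> P" for R
    using rational_map_fibre(1)[OF assms(2), of R] assms(3) by auto
  then have "surj \<phi>"
    by (simp add: surj_def)
  \<comment> \<open>Finiteness has to be proved separately: \<open>card\<close> is 0 on infinite
    sets, so the assumed bound alone does not give it.\<close>
  have fin: "finite (galois_orbits (?S n))" for n
    using finite_iter_preimage[of \<phi>] rational_map_fibre(2)[OF assms(2)] assms(3)
    by (simp add: galois_orbits_def orbits_def setcompr_eq_image)
  have orb: "(\<phi> ^^ m) ` ?orb P = ?orb ((\<phi> ^^ m) P)" for m P
    by (intro image_orbit funpow_equivariant rational_map_galois_equivariant[OF assms(2)])
  have onto: "image (\<phi> ^^ m) ` galois_orbits (?S (l + m)) = galois_orbits (?S l)" for l m
    unfolding funpow_image_iter_preimage[OF \<open>surj \<phi>\<close>, of m l \<beta>, symmetric]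
    by (simp add: galois_orbits_def orbits_def setcompr_eq_image image_image orb)
  obtain C where "\<And>n. card (galois_orbits (?S n)) \<le> C"
    using assms(5) by blast
  \<comment> \<open>\<open>Suc C\<close> expresses the bound as a strict one.\<close>
  then obtain l where l: "\<And>n. card (galois_orbits (?S n)) \<le> card (galois_orbits (?S l))"
    using ex_has_greatest_nat[of "\<lambda>_. True" 0 "\<lambda>n. card (galois_orbits (?S n))" "Suc C"]
    by (auto simp: less_Suc_eq_le)
  \<comment> \<open>By \<open>onto\<close> the image has as many elements as there are orbits at
    level \<open>l\<close>, which by maximality is no fewer than at level \<open>l + m\<close>. A
    map on a finite set whose image is no smaller is injective.\<close>
  have inj: "inj_on (image (\<phi> ^^ m)) (galois_orbits (?S (l + m)))" for m
    using l[of "l + m"] card_image_le[OF fin, of "image (\<phi> ^^ m)" "l + m"] fin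
    by (intro eq_card_imp_inj_on) (simp_all add: onto)
  show ?thesis
  proof (intro exI ballI allI)
    fix b m P Q
    assume b: "b \<in> ?S l" and P: "P \<in> iter_preimage \<phi> m b" and Q: "Q \<in> iter_preimage \<phi> m b"
    then have "?orb P \<in> galois_orbits (?S (l + m))" "?orb Q \<in> galois_orbits (?S (l + m))"
      by (auto simp: galois_orbits_def orbits_def iter_preimage_def funpow_add)
    \<comment> \<open>Both sides are the orbit of \<open>b\<close>, the common image of
      \<open>P\<close> and \<open>Q\<close>.\<close>
    moreover have "(\<phi> ^^ m) ` ?orb P = (\<phi> ^^ m) ` ?orb Q"
      using P Q by (simp add: orb iter_preimage_def)
    ultimately have "?orb P = ?orb Q"
      using inj by (auto dest: inj_onD)
    then show "galois_conjugate P Q"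
      using self_in_galois_orbit[of Q] by (simp add: galois_conjugate_def)
  qed
qed

end
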